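(* For every natural number $n$, $$\mathbf V(\mathrm{Conv}(\mathbb{R}^n))=\mathbf V(\mathrm{Conv}(\mathbb{R}^n,\ \mathrm{o.bdd.}))\quad\text{and}\quad \mathbf V(\mathrm{Conv}(\mathbb{R}^n)_{\geq\{0\}})=\mathbf V(\mathrm{Conv}(\mathbb{R}^n,\ \mathrm{o.bdd.})_{\geq\{0\}}).$$
   Context: Natural numbers include $0$. $\mathrm{Conv}(\mathbb{R}^n)$ is the lattice of all convex subsets of $\mathbb{R}^n$ (including $\emptyset$), with $x\wedge y=x\cap y$ and $x\vee y=$ the convex hull of $x\cup y$. $\mathrm{Conv}(\mathbb{R}^n,\ \mathrm{o.bdd.})$ is its sublattice of open bounded convex subsets. The subscript $\geq\{0\}$ denotes the sublattice of those members that contain the origin. For a lattice $L$, $\mathbf V(L)$ is the variety of lattices generated by $L$, i.e. the class of all lattices satisfying every identity (in the binary operations $\wedge,\vee$) that holds in $L$. *)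

theory Defs
  imports "HOL-Analysis.Analysis" "HOL-Library.Function_Algebras"
begin

section \<open>Lattices as algebras, identities and varieties\<close>

record 'a lat =
  lcarrier :: "'a set"
  meet :: "'a \<Rightarrow> 'a \<Rightarrow> 'a"
  join :: "'a \<Rightarrow> 'a \<Rightarrow> 'a"

definition is_lattice :: "'a lat \<Rightarrow> bool" where
  "is_lattice L \<longleftrightarrow>
    (\<forall>x\<in>lcarrier L. \<forall>y\<in>lcarrier L.
        meet L x y \<in> lcarrier L \<and> join L x y \<in> lcarrier L \<and>
        meet L x y = meet L y x \<and> join L x y = join L y x \<and>
        meet L x (join L x y) = x \<and> join L x (meet L x y) = x) \<and>
    (\<forall>x\<in>lcarrier L. \<forall>y\<in>lcarrier L. \<forall>z\<in>lcarrier L.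
        meet L (meet L x y) z = meet L x (meet L y z) \<and>
        join L (join L x y) z = join L x (join L y z))"

datatype lterm = Var nat | Meet lterm lterm | Join lterm lterm

primrec eval_term :: "'a lat \<Rightarrow> (nat \<Rightarrow> 'a) \<Rightarrow> lterm \<Rightarrow> 'a" where
  "eval_term L v (Var i) = v i"
| "eval_term L v (Meet s t) = meet L (eval_term L v s) (eval_term L v t)"
| "eval_term L v (Join s t) = join L (eval_term L v s) (eval_term L v t)"

definition satisfies_identity :: "'a lat \<Rightarrow> lterm \<Rightarrow> lterm \<Rightarrow> bool" where
  "satisfies_identity L s t \<longleftrightarrow>
    (\<forall>v. (\<forall>i. v i \<in> lcarrier L) \<longrightarrow> eval_term L v s = eval_term L v t)"

text \<open>A class of lattices is rendered by its members with carrier in the type \<^typ>\<open>'b\<close>,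
  for an arbitrary \<^typ>\<open>'b\<close> that need not be the type \<^typ>\<open>'a\<close> underlying \<open>L\<close>.\<close>

definition variety :: "'a lat \<Rightarrow> 'b lat set" where
  "variety L = {M. is_lattice M \<and>
     (\<forall>s t. satisfies_identity L s t \<longrightarrow> satisfies_identity M s t)}"

section \<open>Convex sets in n-dimensional space, including n = 0\<close>

instantiation "fun" :: (type, real_vector) real_vector
begin

definition scaleR_fun :: "real \<Rightarrow> ('a \<Rightarrow> 'b) \<Rightarrow> 'a \<Rightarrow> 'b" where
  "scaleR_fun c f = (\<lambda>x. c *\<^sub>R f x)"

instance
  by standard (simp_all add: scaleR_fun_def fun_eq_iff algebra_simps)

end

text \<open>The space is \<^const>\<open>Euclidean_space\<close>: the sequences vanishing from index \<open>n\<close> on. It is a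
  linear subspace of all sequences, so convex hulls of its subsets stay inside it.\<close>

definition Conv :: "nat \<Rightarrow> (nat \<Rightarrow> real) set lat" where
  "Conv n = \<lparr>lcarrier = {S. S \<subseteq> topspace (Euclidean_space n) \<and> convex S},
             meet = (\<inter>),
             join = (\<lambda>S T. convex hull (S \<union> T))\<rparr>"

text \<open>The constant \<^const>\<open>bounded\<close> on \<^typ>\<open>nat \<Rightarrow> real\<close> refers to a bounded metric for the product
  topology; the Euclidean norm is meant here.\<close>

definition euclidean_bounded :: "nat \<Rightarrow> (nat \<Rightarrow> real) set \<Rightarrow> bool" where
  "euclidean_bounded n S \<longleftrightarrow> (\<exists>B. \<forall>x\<in>S. L2_set x {..<n} \<le> B)"

definition Conv_obdd :: "nat \<Rightarrow> (nat \<Rightarrow> real) set lat" where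
  "Conv_obdd n = (Conv n)\<lparr>lcarrier :=
     {S \<in> lcarrier (Conv n). openin (Euclidean_space n) S \<and> euclidean_bounded n S}\<rparr>"

definition above_origin :: "(nat \<Rightarrow> real) set lat \<Rightarrow> (nat \<Rightarrow> real) set lat" where
  "above_origin L = L\<lparr>lcarrier := {S \<in> lcarrier L. {0} \<subseteq> S}\<rparr>"

section \<open>All four structures are lattices\<close>

lemma convex_topspace_Euclidean_space: "convex (topspace (Euclidean_space n))"
  by (auto simp: convex_def topspace_Euclidean_space scaleR_fun_def)

lemma is_lattice_Conv: "is_lattice (Conv n)"
proof -
  have 1: "convex hull (S \<union> T) \<subseteq> topspace (Euclidean_space n)"
    if "S \<subseteq> topspace (Euclidean_space n)" "T \<subseteq> topspace (Euclidean_space n)" for S T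
    using that by (intro hull_minimal convex_topspace_Euclidean_space) auto
  have 2: "convex hull (convex hull (S \<union> T) \<union> U) = convex hull (S \<union> convex hull (T \<union> U))"
    for S T U :: "(nat \<Rightarrow> real) set"
    by (metis hull_Un_left hull_Un_right sup_assoc)
  have 3: "S \<inter> convex hull (S \<union> T) = S" for S T :: "(nat \<Rightarrow> real) set"
    using hull_subset[of "S \<union> T" convex] by blast
  have 4: "convex hull (S \<union> S \<inter> T) = S" if "convex S" for S T :: "(nat \<Rightarrow> real) set"
    using that by (simp add: sup_inf_absorb convex_hull_eq)
  show ?thesis
    unfolding is_lattice_def Conv_def
    using 1 2 3 4 by (auto simp: convex_Int Un_commute Int_assoc)
qed

lemma continuous_map_Euclidean_space_affine:
  assumes "y \<in> topspace (Euclidean_space n)"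
  shows "continuous_map (Euclidean_space n) (Euclidean_space n) (\<lambda>w. c *\<^sub>R (w - d *\<^sub>R y))"
proof -
  have "continuous_map (Euclidean_space n) euclideanreal (\<lambda>w. w i)" for i
    unfolding Euclidean_space_def
    by (rule continuous_map_from_subtopology) (metis UNIV_I continuous_map_product_coordinates)
  then have "continuous_map (Euclidean_space n) (Euclidean_space n)
      (\<lambda>w i. if i < n then c * (w i - d * y i) else 0)"
    by (auto simp: continuous_map_componentwise_Euclidean_space intro!: continuous_intros)
  then show ?thesis
  proof (rule continuous_map_eq)
    fix w assume "w \<in> topspace (Euclidean_space n)"
    with assms show "(\<lambda>i. if i < n then c * (w i - d * y i) else 0) = c *\<^sub>R (w - d *\<^sub>R y)"
      by (auto simp: topspace_Euclidean_space scaleR_fun_def fun_eq_iff)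
  qed
qed

lemma convex_interior_of_Euclidean_space:
  assumes "convex H"
  shows "convex (Euclidean_space n interior_of H)"
  unfolding convex_def
proof (intro ballI allI impI)
  fix x y and u v :: real
  assume xy: "x \<in> Euclidean_space n interior_of H" "y \<in> Euclidean_space n interior_of H"
    and uv: "0 \<le> u" "0 \<le> v" "u + v = 1"
  show "u *\<^sub>R x + v *\<^sub>R y \<in> Euclidean_space n interior_of H"
  proof (cases "u = 0")
    case True
    with uv xy show ?thesis by simp
  next
    case False
    let ?f = "\<lambda>w. (1 / u) *\<^sub>R (w - v *\<^sub>R y)"
    let ?V = "{w \<in> topspace (Euclidean_space n). ?f w \<in> Euclidean_space n interior_of H}"
    have top: "x \<in> topspace (Euclidean_space n)" "y \<in> topspace (Euclidean_space n)"
      using xy by (meson interior_of_subset_topspace subsetD)+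
    have eq: "w = u *\<^sub>R ?f w + v *\<^sub>R y" for w
      using False by simp
    have "openin (Euclidean_space n) ?V"
      by (rule openin_continuous_map_preimage[OF continuous_map_Euclidean_space_affine[OF top(2)]])
        simp
    moreover have "?V \<subseteq> H"
    proof
      fix w assume "w \<in> ?V"
      then have "?f w \<in> H" "y \<in> H"
        using xy interior_of_subset by fastforce+
      then have "u *\<^sub>R ?f w + v *\<^sub>R y \<in> H"
        using assms uv by (simp only: convex_def)
      then show "w \<in> H" using eq by metis
    qed
    moreover have "u *\<^sub>R x + v *\<^sub>R y \<in> ?V"
    proof -
      have "u *\<^sub>R x + v *\<^sub>R y \<in> topspace (Euclidean_space n)"
        using convex_topspace_Euclidean_space top uv by (simp add: convex_def)
      then show ?thesis using False xy by simp
    qed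
    ultimately show ?thesis
      using interior_of_maximal by blast
  qed
qed

lemma openin_Euclidean_space_convex_hull:
  assumes "openin (Euclidean_space n) S"
  shows "openin (Euclidean_space n) (convex hull S)"
proof -
  have "S \<subseteq> Euclidean_space n interior_of (convex hull S)"
    by (simp add: assms hull_subset interior_of_maximal)
  then have "convex hull S \<subseteq> Euclidean_space n interior_of (convex hull S)"
    by (simp add: hull_minimal convex_interior_of_Euclidean_space)
  then show ?thesis
    using interior_of_subset[of "Euclidean_space n" "convex hull S"]
      openin_interior_of[of "Euclidean_space n" "convex hull S"] by auto
qed

lemma euclidean_bounded_convex_hull_Un:
  assumes "euclidean_bounded n S" "euclidean_bounded n T"
  shows "euclidean_bounded n (convex hull (S \<union> T))"
proof -
  obtain B C where B: "\<And>x. x \<in> S \<Longrightarrow> L2_set x {..<n} \<le> B" "\<And>x. x \<in> T \<Longrightarrow> L2_set x {..<n} \<le> C"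
    using assms by (auto simp: euclidean_bounded_def)
  have "convex {x. L2_set x {..<n} \<le> max B C}"
    unfolding convex_def
  proof (intro ballI allI impI)
    fix x y :: "nat \<Rightarrow> real" and u v :: real
    assume xy: "x \<in> {x. L2_set x {..<n} \<le> max B C}" "y \<in> {x. L2_set x {..<n} \<le> max B C}"
      and uv: "0 \<le> u" "0 \<le> v" "u + v = 1"
    have "L2_set (u *\<^sub>R x + v *\<^sub>R y) {..<n}
        \<le> L2_set (\<lambda>i. u * x i) {..<n} + L2_set (\<lambda>i. v * y i) {..<n}"
      using L2_set_triangle_ineq by (simp add: scaleR_fun_def plus_fun_def)
    also have "\<dots> = u * L2_set x {..<n} + v * L2_set y {..<n}"
      using uv by (simp add: L2_set_right_distrib)
    also have "\<dots> \<le> max B C"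
      using xy uv by (intro convex_bound_le) auto
    finally show "u *\<^sub>R x + v *\<^sub>R y \<in> {x. L2_set x {..<n} \<le> max B C}" by simp
  qed
  then have "convex hull (S \<union> T) \<subseteq> {x. L2_set x {..<n} \<le> max B C}"
    using B by (intro hull_minimal) (auto intro: max.coboundedI1 max.coboundedI2)
  then show ?thesis
    unfolding euclidean_bounded_def by blast
qed

lemma is_lattice_sub:
  assumes "is_lattice L" "A \<subseteq> lcarrier L"
    and "\<And>x y. x \<in> A \<Longrightarrow> y \<in> A \<Longrightarrow> meet L x y \<in> A \<and> join L x y \<in> A"
  shows "is_lattice (L\<lparr>lcarrier := A\<rparr>)"
proof -
  let ?M = "L\<lparr>lcarrier := A\<rparr>"
  have sel: "lcarrier ?M = A" "meet ?M = meet L" "join ?M = join L"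
    by simp_all
  have 1: "meet L x y = meet L y x \<and> join L x y = join L y x \<and>
      meet L x (join L x y) = x \<and> join L x (meet L x y) = x" if "x \<in> A" "y \<in> A" for x y
    using assms(1) subsetD[OF assms(2) that(1)] subsetD[OF assms(2) that(2)]
    unfolding is_lattice_def by blast
  have 2: "meet L (meet L x y) z = meet L x (meet L y z) \<and>
      join L (join L x y) z = join L x (join L y z)" if "x \<in> A" "y \<in> A" "z \<in> A" for x y z
    using assms(1) subsetD[OF assms(2) that(1)] subsetD[OF assms(2) that(2)]
      subsetD[OF assms(2) that(3)]
    unfolding is_lattice_def by blast
  show ?thesis
    unfolding is_lattice_def sel using 1 2 assms(3) by blast
qed

lemma is_lattice_Conv_obdd: "is_lattice (Conv_obdd n)"
  unfolding Conv_obdd_def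
proof (rule is_lattice_sub[OF is_lattice_Conv], goal_cases)
  case (2 S T)
  then have "meet (Conv n) S T \<in> lcarrier (Conv n)" "join (Conv n) S T \<in> lcarrier (Conv n)"
    using is_lattice_Conv[of n] by (auto simp: is_lattice_def)
  with 2 show ?case
    using openin_Euclidean_space_convex_hull[of n "S \<union> T"] euclidean_bounded_convex_hull_Un[of n S T]
    by (auto simp: Conv_def euclidean_bounded_def)
qed auto

lemma is_lattice_above_origin:
  assumes "is_lattice L" "meet L = (\<inter>)" "join L = (\<lambda>S T. convex hull (S \<union> T))"
  shows "is_lattice (above_origin L)"
  unfolding above_origin_def
proof (rule is_lattice_sub[OF assms(1)], goal_cases)
  case (2 S T)
  then have "meet L S T \<in> lcarrier L" "join L S T \<in> lcarrier L"
    using assms(1) by (auto simp: is_lattice_def)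
  moreover have "S \<subseteq> convex hull (S \<union> T)"
    by (meson Un_upper1 hull_subset order_trans)
  ultimately show ?case using 2 assms(2,3) by auto
qed auto

corollary is_lattice_above_origin_Conv: "is_lattice (above_origin (Conv n))"
  by (rule is_lattice_above_origin[OF is_lattice_Conv]) (simp_all add: Conv_def)

corollary is_lattice_above_origin_Conv_obdd: "is_lattice (above_origin (Conv_obdd n))"
  by (rule is_lattice_above_origin[OF is_lattice_Conv_obdd]) (simp_all add: Conv_obdd_def Conv_def)

end

theory Submission
  imports Defs
begin

text \<open>Only one direction is not immediate, since \<open>Conv_obdd n\<close> is a sublattice of \<open>Conv n\<close>. A point \<open>p\<close>
  in the value of a term \<open>s\<close> already lies in the value of \<open>s\<close> at polytopes \<open>P\<^sub>i\<close> inside the given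
  convex sets. Thickening them to the open bounded convex sets \<open>P\<^sub>i + e U\<close> with \<open>U\<close> the open
  cube, an identity \<open>s = t\<close> of \<open>Conv_obdd n\<close> puts \<open>p\<close> into the value of \<open>t\<close> at \<open>P\<^sub>i + e U\<close> for every
  \<open>e > 0\<close>. With the closed cube \<open>C\<close> in place of \<open>U\<close>, the values of \<open>t\<close> at \<open>P\<^sub>i + e C\<close> form a compact
  subset of \<open>[0,1]\<close> times space as \<open>e\<close> ranges over \<open>[0,1]\<close>, so \<open>e\<close> may tend to \<open>0\<close>. To keep the
  origin in all sets, it is added to the vertices of each \<open>P\<^sub>i\<close>.\<close>

section \<open>Convex hulls of unions\<close>

lemma convex_combine_scaled:
  fixes S :: "'a::real_vector set"
  assumes "convex S" "a \<in> S" "b \<in> S" "0 \<le> u" "0 \<le> v"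
  shows "\<exists>c\<in>S. u *\<^sub>R a + v *\<^sub>R b = (u + v) *\<^sub>R c"
proof (cases "u + v = 0")
  case True
  with assms have "u = 0" "v = 0" by auto
  with assms show ?thesis by auto
next
  case False
  with assms have pos: "0 < u + v" by simp
  let ?c = "(u / (u + v)) *\<^sub>R a + (v / (u + v)) *\<^sub>R b"
  have "u / (u + v) + v / (u + v) = 1" using pos by (simp flip: add_divide_distrib)
  then have "?c \<in> S"
    using assms pos by (intro convexD) auto
  moreover have "u *\<^sub>R a + v *\<^sub>R b = (u + v) *\<^sub>R ?c"
    using pos by (simp add: scaleR_add_right)
  ultimately show ?thesis by blast
qed

text \<open>The sets \<open>S\<close> and \<open>T\<close> are adjoined to cover the case that one
  of them is empty and there are no segments; the empty set does belong to \<open>Conv n\<close>. If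
  both are nonempty, the union of the segments is already convex and contains them.\<close>

lemma convex_hull_Un_eq:
  fixes S T :: "'a::real_vector set"
  assumes "convex S" "convex T"
  shows "convex hull (S \<union> T) =
    S \<union> T \<union> {(1 - u) *\<^sub>R a + u *\<^sub>R b | u a b. 0 \<le> u \<and> u \<le> 1 \<and> a \<in> S \<and> b \<in> T}"
    (is "_ = S \<union> T \<union> ?M")
proof
  have "(1 - u) *\<^sub>R a + u *\<^sub>R b \<in> convex hull (S \<union> T)"
    if "0 \<le> u" "u \<le> 1" "a \<in> S" "b \<in> T" for u a b
    using that by (intro convexD[OF convex_convex_hull]) (auto simp: hull_inc)
  then have "?M \<subseteq> convex hull (S \<union> T)" by blast
  then show "S \<union> T \<union> ?M \<subseteq> convex hull (S \<union> T)"
    using hull_subset[of "S \<union> T" convex] by blast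
next
  show "convex hull (S \<union> T) \<subseteq> S \<union> T \<union> ?M"
  proof (cases "S = {} \<or> T = {}")
    case True
    then show ?thesis using assms by (auto simp: hull_same)
  next
    case False
    then obtain s0 t0 where "s0 \<in> S" "t0 \<in> T" by blast
    have M: "u *\<^sub>R a + v *\<^sub>R b \<in> ?M"
      if "0 \<le> u" "0 \<le> v" "u + v = 1" "a \<in> S" "b \<in> T" for u v a b
    proof -
      have "u = 1 - v" "v \<le> 1" using that by auto
      then show ?thesis using that by blast
    qed
    have "S \<subseteq> ?M" using M[of 1 0 _ t0] \<open>t0 \<in> T\<close> by auto
    moreover have "T \<subseteq> ?M" using M[of 0 1 s0] \<open>s0 \<in> S\<close> by auto
    moreover have "convex ?M"
    proof (rule convexI)
      fix x y and p q :: real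
      assume "x \<in> ?M" "y \<in> ?M" and pq: "0 \<le> p" "0 \<le> q" "p + q = 1"
      then obtain u a b u' a' b'
        where x: "0 \<le> u" "u \<le> 1" "a \<in> S" "b \<in> T" "x = (1 - u) *\<^sub>R a + u *\<^sub>R b"
          and y: "0 \<le> u'" "u' \<le> 1" "a' \<in> S" "b' \<in> T" "y = (1 - u') *\<^sub>R a' + u' *\<^sub>R b'"
        by blast
      \<comment> \<open>The combination of two points on segments is regrouped into an
        \<open>S\<close>-part and a \<open>T\<close>-part, each of which collapses to one scaled
        point.\<close>
      obtain c where c: "c \<in> S"
        "(p * (1 - u)) *\<^sub>R a + (q * (1 - u')) *\<^sub>R a' = (p * (1 - u) + q * (1 - u')) *\<^sub>R c"
        using convex_combine_scaled[OF assms(1) x(3) y(3), of "p * (1 - u)" "q * (1 - u')"]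
          x y pq by auto
      obtain d where d: "d \<in> T"
        "(p * u) *\<^sub>R b + (q * u') *\<^sub>R b' = (p * u + q * u') *\<^sub>R d"
        using convex_combine_scaled[OF assms(2) x(4) y(4), of "p * u" "q * u'"] x y pq by auto
      have "p *\<^sub>R x + q *\<^sub>R y = ((p * (1 - u)) *\<^sub>R a + (q * (1 - u')) *\<^sub>R a')
          + ((p * u) *\<^sub>R b + (q * u') *\<^sub>R b')"
        using x y by (simp add: scaleR_add_right)
      also have "\<dots> = (p * (1 - u) + q * (1 - u')) *\<^sub>R c + (p * u + q * u') *\<^sub>R d"
        using c d by simp
      also have "\<dots> \<in> ?M"
      proof (rule M)
        show "p * (1 - u) + q * (1 - u') + (p * u + q * u') = 1"
          using pq by (simp add: algebra_simps)
      qed (use x y pq c d in auto)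
      finally show "p *\<^sub>R x + q *\<^sub>R y \<in> ?M" .
    qed
    ultimately show ?thesis by (intro hull_minimal subset_trans[OF _ Un_upper2]) auto
  qed
qed

text \<open>At most one point of each set is needed, since \<open>p\<close> lies in
  \<open>S\<close>, in \<open>T\<close> or on a segment between them.\<close>

lemma hull_Un_finite_support:
  fixes S T :: "'a::real_vector set"
  assumes "convex S" "convex T" "p \<in> convex hull (S \<union> T)"
  obtains A B where "finite A" "finite B" "A \<subseteq> S" "B \<subseteq> T" "p \<in> convex hull (A \<union> B)"
proof -
  consider "p \<in> S" | "p \<in> T"
    | u a b where "0 \<le> u" "u \<le> 1" "a \<in> S" "b \<in> T" "p = (1 - u) *\<^sub>R a + u *\<^sub>R b"
    using assms by (auto simp: convex_hull_Un_eq)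
  then show ?thesis
  proof cases
    case 1
    then show ?thesis using that[of "{p}" "{}"] by simp
  next
    case 2
    then show ?thesis using that[of "{}" "{p}"] by simp
  next
    case 3
    then have "p \<in> convex hull ({a} \<union> {b})"
      using convexD[OF convex_convex_hull, of a "{a} \<union> {b}" b "1 - u" u] by (simp add: hull_inc)
    with 3 show ?thesis using that[of "{a}" "{b}"] by simp
  qed
qed

section \<open>Terms evaluated in convex sets\<close>

lemma meet_Conv [simp]: "meet (Conv n) S T = S \<inter> T"
  and join_Conv [simp]: "join (Conv n) S T = convex hull (S \<union> T)"
  by (simp_all add: Conv_def)

text \<open>Evaluation depends on the operations only, so terms for all four lattices can be
  evaluated in \<open>Conv n\<close>.\<close>

lemma eval_term_same_ops:
  "meet L = meet M \<Longrightarrow> join L = join M \<Longrightarrow> eval_term L v t = eval_term M v t"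
  by (induction t) simp_all

lemma convex_eval_term:
  "(\<And>i. convex (v i)) \<Longrightarrow> convex (eval_term (Conv n) v t)"
  by (induction t) (auto intro: convex_Int)

lemma eval_term_mono:
  "(\<And>i. v i \<subseteq> w i) \<Longrightarrow> eval_term (Conv n) v t \<subseteq> eval_term (Conv n) w t"
proof (induction t)
  case (Join s t)
  then show ?case by (auto intro!: hull_mono Un_mono)
qed auto

text \<open>Each point of a hull is supported by finitely many points, and monotonicity allows
  finite supports to be merged. This replaces arbitrary convex sets, possibly unbounded or not
  closed, by polytopes.\<close>

lemma eval_term_finite_support:
  assumes "\<And>i. convex (v i)" "p \<in> eval_term (Conv n) v t"
  shows "\<exists>F. (\<forall>i. finite (F i) \<and> F i \<subseteq> v i) \<and> p \<in> eval_term (Conv n) (\<lambda>i. convex hull F i) t"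
  using assms(2)
proof (induction t arbitrary: p)
  case (Var j)
  then show ?case
    \<comment> \<open>Variables other than \<open>j\<close> receive the empty set, the only choice
      that works even when \<open>v i\<close> is empty.\<close>
    by (intro exI[of _ "\<lambda>i. if i = j then {p} else {}"]) auto
next
  case (Meet s t)
  then obtain F G where F: "\<forall>i. finite (F i) \<and> F i \<subseteq> v i"
      "p \<in> eval_term (Conv n) (\<lambda>i. convex hull F i) s"
    and G: "\<forall>i. finite (G i) \<and> G i \<subseteq> v i"
      "p \<in> eval_term (Conv n) (\<lambda>i. convex hull G i) t"
    by (metis IntE eval_term.simps(2) meet_Conv)
  have "p \<in> eval_term (Conv n) (\<lambda>i. convex hull (F i \<union> G i)) s"
    "p \<in> eval_term (Conv n) (\<lambda>i. convex hull (F i \<union> G i)) t"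
    using F(2) G(2) eval_term_mono[of "\<lambda>i. convex hull F i" "\<lambda>i. convex hull (F i \<union> G i)"]
      eval_term_mono[of "\<lambda>i. convex hull G i" "\<lambda>i. convex hull (F i \<union> G i)"]
    by (meson Un_upper1 Un_upper2 hull_mono subsetD)+
  then show ?case
    using F(1) G(1) by (intro exI[of _ "\<lambda>i. F i \<union> G i"]) auto
next
  case (Join s t)
  have "p \<in> convex hull (eval_term (Conv n) v s \<union> eval_term (Conv n) v t)"
    using Join.prems by simp
  then obtain A B where A: "finite A" "A \<subseteq> eval_term (Conv n) v s"
    and B: "finite B" "B \<subseteq> eval_term (Conv n) v t" and p: "p \<in> convex hull (A \<union> B)"
    by (rule hull_Un_finite_support[OF convex_eval_term[OF assms(1)] convex_eval_term[OF assms(1)]])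
  have "\<forall>a\<in>A. \<exists>F. (\<forall>i. finite (F i) \<and> F i \<subseteq> v i) \<and>
      a \<in> eval_term (Conv n) (\<lambda>i. convex hull F i) s"
    using Join.IH(1) A by blast
  then obtain F where F: "\<And>a i. a \<in> A \<Longrightarrow> finite (F a i) \<and> F a i \<subseteq> v i"
      "\<And>a. a \<in> A \<Longrightarrow> a \<in> eval_term (Conv n) (\<lambda>i. convex hull F a i) s"
    by metis
  have "\<forall>b\<in>B. \<exists>F. (\<forall>i. finite (F i) \<and> F i \<subseteq> v i) \<and>
      b \<in> eval_term (Conv n) (\<lambda>i. convex hull F i) t"
    using Join.IH(2) B by blast
  then obtain G where G: "\<And>b i. b \<in> B \<Longrightarrow> finite (G b i) \<and> G b i \<subseteq> v i"
      "\<And>b. b \<in> B \<Longrightarrow> b \<in> eval_term (Conv n) (\<lambda>i. convex hull G b i) t"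
    by metis
  \<comment> \<open>Each point of \<open>A\<close> and \<open>B\<close> has its own support;
    finiteness of \<open>A\<close> and \<open>B\<close> keeps the union of these supports
    finite.\<close>
  define H where "H = (\<lambda>i. (\<Union>a\<in>A. F a i) \<union> (\<Union>b\<in>B. G b i))"
  have Hs: "a \<in> A \<Longrightarrow> F a i \<subseteq> H i" "b \<in> B \<Longrightarrow> G b i \<subseteq> H i" for a b i
    by (auto simp: H_def)
  have "A \<subseteq> eval_term (Conv n) (\<lambda>i. convex hull H i) s"
  proof
    fix a assume "a \<in> A"
    then show "a \<in> eval_term (Conv n) (\<lambda>i. convex hull H i) s"
      using eval_term_mono[of "\<lambda>i. convex hull F a i" "\<lambda>i. convex hull H i"] F(2)
      by (meson Hs(1) hull_mono subsetD)
  qed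
  moreover have "B \<subseteq> eval_term (Conv n) (\<lambda>i. convex hull H i) t"
  proof
    fix b assume "b \<in> B"
    then show "b \<in> eval_term (Conv n) (\<lambda>i. convex hull H i) t"
      using eval_term_mono[of "\<lambda>i. convex hull G b i" "\<lambda>i. convex hull H i"] G(2)
      by (meson Hs(2) hull_mono subsetD)
  qed
  ultimately have "p \<in> eval_term (Conv n) (\<lambda>i. convex hull H i) (Join s t)"
    using p hull_mono[OF Un_mono, of A _ B _ convex] unfolding eval_term.simps join_Conv by blast
  moreover have "finite (H i)" for i
    using A B F(1) G(1) by (simp add: H_def)
  moreover have "H i \<subseteq> v i" for i
    unfolding H_def using F(1) G(1) by (simp add: Un_least UN_least)
  ultimately show ?case by blast
qed

section \<open>Compactness\<close>

text \<open>Continuity into a product topology is checked coordinatewise, which reduces vector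
  operations on functions to real arithmetic.\<close>

lemma continuous_on_fun_add:
  fixes f g :: "'a::topological_space \<Rightarrow> 'i \<Rightarrow> real"
  assumes "continuous_on S f" "continuous_on S g"
  shows "continuous_on S (\<lambda>z. f z + g z)"
  using assms[THEN continuous_on_product_then_coordinatewise]
  by (auto intro!: continuous_on_coordinatewise_then_product continuous_on_add)

lemma continuous_on_fun_scaleR:
  fixes f :: "'a::topological_space \<Rightarrow> real" and g :: "'a \<Rightarrow> 'i \<Rightarrow> real"
  assumes "continuous_on S f" "continuous_on S g"
  shows "continuous_on S (\<lambda>z. f z *\<^sub>R g z)"
  using assms(1) assms(2)[THEN continuous_on_product_then_coordinatewise]
  by (auto simp: scaleR_fun_def intro!: continuous_on_coordinatewise_then_product continuous_on_mult)

text \<open>Adding a vertex \<open>a\<close> to a nonempty set turns the hull into the image of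
  \<open>[0,1]\<close> times the old hull under the map that draws segments from
  \<open>a\<close>.\<close>

lemma compact_convex_hull_finite:
  fixes F :: "('i \<Rightarrow> real) set"
  assumes "finite F"
  shows "compact (convex hull F)"
  using assms
proof induction
  case (insert a F)
  show ?case
  proof (cases "F = {}")
    case False
    let ?f = "\<lambda>(u, x). (1 - u) *\<^sub>R a + u *\<^sub>R (x :: 'i \<Rightarrow> real)"
    have "continuous_on ({0..1} \<times> (convex hull F)) ?f"
      unfolding case_prod_beta
      by (intro continuous_on_fun_add continuous_on_fun_scaleR continuous_intros)
    then have "compact (?f ` ({0..1} \<times> (convex hull F)))"
      using insert.IH by (intro compact_continuous_image compact_Times) auto
    also have "?f ` ({0..1} \<times> (convex hull F)) = convex hull (insert a F)"
      using False by (simp add: convex_hull_insert_alt image_def) fastforce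
    finally show ?thesis .
  qed simp
qed simp

text \<open>Compactness concerns the whole graph over the parameters \<open>e\<close> rather than
  single fibres, because fibres will be compared as \<open>e\<close> tends to a limit.\<close>

lemma compact_Sigma_hull_Un:
  fixes A B :: "real \<Rightarrow> ('i::countable \<Rightarrow> real) set"
  assumes "compact (Sigma I A)" "compact (Sigma I B)"
    and conv: "\<And>e. convex (A e)" "\<And>e. convex (B e)"
  shows "compact (SIGMA e:I. convex hull (A e \<union> B e))"
proof -
  let ?X = "{0..1::real} \<times> (Sigma I A \<times> Sigma I B)"
  \<comment> \<open>A point of \<open>?X\<close> has the form \<open>(u, (e, a), (e', b))\<close>;
    the closed condition \<open>?D\<close> forces \<open>e = e'\<close>, so that both endpoints
    belong to the same fibre.\<close>
  let ?D = "{z. fst (fst (snd z)) = fst (snd (snd z))}"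
  let ?f = "\<lambda>z. (fst (fst (snd z)),
    (1 - fst z) *\<^sub>R snd (fst (snd z)) + fst z *\<^sub>R (snd (snd (snd z)) :: 'i \<Rightarrow> real))"
  have "compact (?X \<inter> ?D)"
    using assms(1,2) by (intro compact_Int_closed compact_Times closed_Collect_eq continuous_intros) auto
  moreover have "continuous_on (?X \<inter> ?D) ?f"
    by (intro continuous_on_Pair continuous_on_fun_add continuous_on_fun_scaleR continuous_intros)
  \<comment> \<open>The two graphs are adjoined for those \<open>e\<close> at which one fibre is
    empty and no segments exist.\<close>
  ultimately have "compact (Sigma I A \<union> Sigma I B \<union> ?f ` (?X \<inter> ?D))"
    using assms(1,2) by (intro compact_Un compact_continuous_image)
  also have "?f ` (?X \<inter> ?D) = {(e, (1 - u) *\<^sub>R a + u *\<^sub>R b) | e u a b.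
      e \<in> I \<and> 0 \<le> u \<and> u \<le> 1 \<and> a \<in> A e \<and> b \<in> B e}" (is "_ = ?M")
  proof
    show "?f ` (?X \<inter> ?D) \<subseteq> ?M"
    proof
      fix z assume "z \<in> ?f ` (?X \<inter> ?D)"
      then obtain x where x: "x \<in> ?X \<inter> ?D" "z = ?f x" by (rule imageE)
      obtain u e a e' b where "x = (u, (e, a), (e', b))" by (metis prod.exhaust)
      moreover from this x(1) have "e' = e" by simp
      ultimately have "x = (u, (e, a), (e, b))" by simp
      with x have "z = (e, (1 - u) *\<^sub>R a + u *\<^sub>R b)"
        "e \<in> I" "0 \<le> u" "u \<le> 1" "a \<in> A e" "b \<in> B e" by simp_all
      then show "z \<in> ?M" by blast
    qed
    show "?M \<subseteq> ?f ` (?X \<inter> ?D)"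
    proof
      fix z assume "z \<in> ?M"
      then obtain e u a b where z: "z = (e, (1 - u) *\<^sub>R a + u *\<^sub>R b)"
        "e \<in> I" "0 \<le> u" "u \<le> 1" "a \<in> A e" "b \<in> B e" by blast
      show "z \<in> ?f ` (?X \<inter> ?D)"
        by (rule image_eqI[of _ _ "(u, (e, a), (e, b))"]) (use z in simp_all)
    qed
  qed
  also have "Sigma I A \<union> Sigma I B \<union> ?M = (SIGMA e:I. convex hull (A e \<union> B e))"
    unfolding convex_hull_Un_eq[OF conv] by blast
  finally show ?thesis .
qed

text \<open>Intersections need not vary continuously with \<open>e\<close>, but compactness of the
  graph survives both intersections and hulls of unions. This one-sided form of continuity suffices
  for the limit.\<close>

lemma compact_Sigma_eval_term:
  fixes I :: "real set"
  assumes "\<And>i. compact (SIGMA e:I. v e i)" "\<And>e i. convex (v e i)"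
  shows "compact (SIGMA e:I. eval_term (Conv n) (v e) t)"
proof (induction t)
  case (Meet s t)
  have "(SIGMA e:I. eval_term (Conv n) (v e) (Meet s t)) =
      (SIGMA e:I. eval_term (Conv n) (v e) s) \<inter> (SIGMA e:I. eval_term (Conv n) (v e) t)"
    by auto
  then show ?case using compact_Int[OF Meet] by (simp only:)
next
  case (Join s t)
  show ?case
    unfolding eval_term.simps join_Conv
    by (rule compact_Sigma_hull_Un[OF Join convex_eval_term convex_eval_term]) (fact assms(2))+
next
  case (Var i)
  show ?case unfolding eval_term.simps by (rule assms(1))
qed

section \<open>Thickening by a cube\<close>

text \<open>This is the Minkowski sum of \<open>S\<close> with a dilate of \<open>U\<close>; keeping
  \<open>U\<close> as a parameter serves the open and the closed cube alike.\<close>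

definition thicken :: "'a::real_vector set \<Rightarrow> 'a set \<Rightarrow> real \<Rightarrow> 'a set" where
  "thicken U S e = {a + e *\<^sub>R u | a u. a \<in> S \<and> u \<in> U}"

lemma thicken_mono: "U \<subseteq> V \<Longrightarrow> thicken U S e \<subseteq> thicken V S e"
  by (auto simp: thicken_def)

lemma subset_thicken:
  assumes "0 \<in> U" shows "S \<subseteq> thicken U S e"
proof
  fix a assume "a \<in> S"
  with assms have "a = a + e *\<^sub>R 0 \<and> a \<in> S \<and> 0 \<in> U" by simp
  then show "a \<in> thicken U S e" unfolding thicken_def by blast
qed

lemma thicken_0: "thicken U S 0 \<subseteq> S"
  by (auto simp: thicken_def)

lemma convex_thicken:
  assumes "convex S" "convex U" shows "convex (thicken U S e)"
proof -
  have "thicken U S e = (\<Union>x\<in>S. \<Union>y\<in>(*\<^sub>R) e ` U. {x + y})"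
    by (auto simp: thicken_def)
  then show ?thesis
    using convex_sums[OF assms(1) convex_scaling[OF assms(2)]] by simp
qed

text \<open>The graph is one continuous image of \<open>I \<times> S \<times> U\<close>.\<close>

lemma compact_Sigma_thicken:
  fixes S U :: "('i \<Rightarrow> real) set"
  assumes "compact I" "compact S" "compact U"
  shows "compact (SIGMA e:I. thicken U S e)"
proof -
  let ?f = "\<lambda>(e, a, u). (e, a + e *\<^sub>R (u :: 'i \<Rightarrow> real))"
  have "continuous_on (I \<times> S \<times> U) ?f"
    unfolding case_prod_beta
    by (intro continuous_on_Pair continuous_on_fun_add continuous_on_fun_scaleR continuous_intros)
  then have "compact (?f ` (I \<times> S \<times> U))"
    using assms by (intro compact_continuous_image compact_Times)
  also have "?f ` (I \<times> S \<times> U) = (SIGMA e:I. thicken U S e)"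
    unfolding thicken_def by (simp add: image_def) fastforce
  finally show ?thesis .
qed

definition open_cube :: "nat \<Rightarrow> (nat \<Rightarrow> real) set" where
  "open_cube n = {u \<in> topspace (Euclidean_space n). \<forall>i<n. \<bar>u i\<bar> < 1}"

text \<open>The form of a full product, with factor \<open>{0}\<close> from index \<open>n\<close>
  on, lets Tychonoff's theorem give compactness.\<close>

definition closed_cube :: "nat \<Rightarrow> (nat \<Rightarrow> real) set" where
  "closed_cube n = (\<Pi>\<^sub>E i\<in>UNIV. if i < n then {-1..1} else {0})"

lemma closed_cube_iff: "x \<in> closed_cube n \<longleftrightarrow> (\<forall>i. x i \<in> (if i < n then {-1..1} else {0}))"
  by (simp add: closed_cube_def PiE_iff)

lemma zero_in_open_cube: "0 \<in> open_cube n"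
  by (simp add: open_cube_def topspace_Euclidean_space)

lemma open_cube_subset_closed_cube: "open_cube n \<subseteq> closed_cube n"
proof
  fix u assume "u \<in> open_cube n"
  then have "u i \<in> (if i < n then {-1..1} else {0})" for i
    using abs_le_iff[of "u i" 1] by (auto simp: open_cube_def topspace_Euclidean_space)
  then show "u \<in> closed_cube n" unfolding closed_cube_iff by blast
qed

lemma compact_closed_cube: "compact (closed_cube n)"
proof -
  have "compactin (product_topology (\<lambda>i. euclidean) UNIV) (closed_cube n)"
    unfolding closed_cube_def by (subst compactin_PiE) auto
  then show ?thesis by (simp add: euclidean_product_topology)
qed

lemma convex_closed_cube: "convex (closed_cube n)"
proof (rule convexI)
  fix x y and u v :: real
  assume xy: "x \<in> closed_cube n" "y \<in> closed_cube n" and uv: "0 \<le> u" "0 \<le> v" "u + v = 1"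
  have "u *\<^sub>R x i + v *\<^sub>R y i \<in> (if i < n then {-1..1} else {0})" for i
  proof (rule convexD[OF _ _ _ uv])
    show "x i \<in> (if i < n then {-1..1} else {0})" "y i \<in> (if i < n then {-1..1} else {0})"
      using xy unfolding closed_cube_iff by blast+
  qed simp
  then show "u *\<^sub>R x + v *\<^sub>R y \<in> closed_cube n"
    unfolding closed_cube_iff plus_fun_def scaleR_fun_def by blast
qed

lemma convex_open_cube: "convex (open_cube n)"
proof (rule convexI)
  fix x y and u v :: real
  assume xy: "x \<in> open_cube n" "y \<in> open_cube n" and uv: "0 \<le> u" "0 \<le> v" "u + v = 1"
  have "\<bar>(u *\<^sub>R x + v *\<^sub>R y) i\<bar> < 1" if "i < n" for i
  proof -
    have "u *\<^sub>R x i + v *\<^sub>R y i \<in> {-1<..<1}"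
    proof (rule convexD[OF _ _ _ uv])
      show "x i \<in> {-1<..<1}" "y i \<in> {-1<..<1}"
        using xy that unfolding open_cube_def by (auto simp: abs_less_iff)
    qed simp
    then show ?thesis by (auto simp: scaleR_fun_def)
  qed
  moreover have "u *\<^sub>R x + v *\<^sub>R y \<in> topspace (Euclidean_space n)"
    using xy by (intro convexD[OF convex_topspace_Euclidean_space _ _ uv]) (auto simp: open_cube_def)
  ultimately show "u *\<^sub>R x + v *\<^sub>R y \<in> open_cube n"
    by (simp add: open_cube_def)
qed

lemma openin_open_cube: "openin (Euclidean_space n) (open_cube n)"
proof -
  \<comment> \<open>A basic open set of the product constrains only finitely many coordinates, hence
    the whole line from index \<open>n\<close> on. The vanishing of those coordinates comes from the
    subspace.\<close>
  let ?X = "\<lambda>i. if i < n then {-1<..<1} else (UNIV :: real set)"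
  have "{i. ?X i \<noteq> topspace euclideanreal} \<subseteq> {..<n}" by auto
  then have "finite {i. ?X i \<noteq> topspace euclideanreal}"
    by (rule finite_subset) simp
  then have "openin (powertop_real UNIV) (\<Pi>\<^sub>E i\<in>UNIV. ?X i)"
    by (intro product_topology_basis) simp_all
  then have "openin (Euclidean_space n) ({x. \<forall>i\<ge>n. x i = 0} \<inter> (\<Pi>\<^sub>E i\<in>UNIV. ?X i))"
    unfolding Euclidean_space_def by (rule openin_subtopology_Int2)
  also have "{x. \<forall>i\<ge>n. x i = 0} \<inter> (\<Pi>\<^sub>E i\<in>UNIV. ?X i) = open_cube n"
    by (auto simp: open_cube_def topspace_Euclidean_space PiE_iff abs_less_iff
        if_distrib[where f = "\<lambda>A. z \<in> A" for z] if_bool_eq_conj)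
  finally show ?thesis .
qed

text \<open>A point \<open>w\<close> is in the thickening iff \<open>(w - a) / e\<close> is in the
  cube for some \<open>a\<close> in \<open>S\<close>, so the thickening is a union of preimages of
  the open cube.\<close>

lemma openin_thicken_open_cube:
  assumes "S \<subseteq> topspace (Euclidean_space n)" "0 < e"
  shows "openin (Euclidean_space n) (thicken (open_cube n) S e)"
proof -
  let ?E = "topspace (Euclidean_space n)"
  have sub: "a + e *\<^sub>R u \<in> ?E" if "a \<in> S" "u \<in> open_cube n" for a u
    using assms that by (auto simp: open_cube_def topspace_Euclidean_space scaleR_fun_def subset_iff)
  \<comment> \<open>The factor \<open>1\<close> before \<open>a\<close> matches
    \<open>continuous_map_Euclidean_space_affine\<close> with \<open>d = 1\<close>.\<close>
  have "thicken (open_cube n) S e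
      = (\<Union>a\<in>S. {w \<in> ?E. (1 / e) *\<^sub>R (w - 1 *\<^sub>R a) \<in> open_cube n})" (is "?l = ?r")
  proof
    show "?l \<subseteq> ?r" using sub assms(2) by (auto simp: thicken_def)
    have "w \<in> ?l" if "a \<in> S" "(1 / e) *\<^sub>R (w - 1 *\<^sub>R a) \<in> open_cube n" for w a
    proof -
      have "w = a + e *\<^sub>R ((1 / e) *\<^sub>R (w - 1 *\<^sub>R a))" using assms(2) by simp
      with that show ?thesis unfolding thicken_def by blast
    qed
    then show "?r \<subseteq> ?l" by blast
  qed
  moreover have "openin (Euclidean_space n) {w \<in> ?E. (1 / e) *\<^sub>R (w - 1 *\<^sub>R a) \<in> open_cube n}"
    if "a \<in> S" for a
    using that assms(1)
    by (intro openin_continuous_map_preimage[OF continuous_map_Euclidean_space_affine]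
        openin_open_cube) auto
  ultimately show ?thesis by (auto intro!: openin_Union)
qed

lemma euclidean_bounded_finite: "finite F \<Longrightarrow> euclidean_bounded n F"
  unfolding euclidean_bounded_def
  \<comment> \<open>A sum of norms, unlike a maximum, is a bound for the empty set too.\<close>
  by (rule exI[of _ "\<Sum>x\<in>F. L2_set x {..<n}"]) (auto intro: member_le_sum)

lemma euclidean_bounded_thicken:
  assumes "euclidean_bounded n S" "euclidean_bounded n U" "0 \<le> e"
  shows "euclidean_bounded n (thicken U S e)"
proof -
  obtain B C where B: "\<And>x. x \<in> S \<Longrightarrow> L2_set x {..<n} \<le> B" "\<And>x. x \<in> U \<Longrightarrow> L2_set x {..<n} \<le> C"
    using assms by (auto simp: euclidean_bounded_def)
  have "L2_set (a + e *\<^sub>R u) {..<n} \<le> B + e * C" if "a \<in> S" "u \<in> U" for a u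
  proof -
    have "L2_set (a + e *\<^sub>R u) {..<n} \<le> L2_set a {..<n} + L2_set (\<lambda>i. e * u i) {..<n}"
      using L2_set_triangle_ineq by (simp add: scaleR_fun_def plus_fun_def)
    also have "\<dots> = L2_set a {..<n} + e * L2_set u {..<n}"
      using assms(3) by (simp add: L2_set_right_distrib)
    also have "\<dots> \<le> B + e * C"
      using B that assms(3) by (intro add_mono mult_left_mono) auto
    finally show ?thesis .
  qed
  then show ?thesis by (auto simp: euclidean_bounded_def thicken_def)
qed

lemma euclidean_bounded_open_cube: "euclidean_bounded n (open_cube n)"
  unfolding euclidean_bounded_def
proof (intro exI ballI)
  fix x assume "x \<in> open_cube n"
  then have "(\<Sum>i<n. \<bar>x i\<bar>) \<le> (\<Sum>i<n. 1)"
    by (intro sum_mono) (auto simp: open_cube_def less_imp_le)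
  with L2_set_le_sum_abs[of x "{..<n}"] show "L2_set x {..<n} \<le> real n" by simp
qed

lemma thicken_polytope_in_Conv_obdd:
  assumes "finite F" "F \<subseteq> topspace (Euclidean_space n)" "0 < e"
  shows "thicken (open_cube n) (convex hull F) e \<in> lcarrier (Conv_obdd n)"
proof -
  have "convex hull F \<subseteq> topspace (Euclidean_space n)"
    by (simp add: assms(2) hull_minimal convex_topspace_Euclidean_space)
  then have "openin (Euclidean_space n) (thicken (open_cube n) (convex hull F) e)"
    using openin_thicken_open_cube assms(3) by blast
  moreover have "euclidean_bounded n (convex hull F)"
    using euclidean_bounded_convex_hull_Un[of n F F] euclidean_bounded_finite[OF assms(1)] by simp
  then have "euclidean_bounded n (thicken (open_cube n) (convex hull F) e)"
    using assms(3) by (intro euclidean_bounded_thicken euclidean_bounded_open_cube) auto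
  ultimately show ?thesis
    by (auto simp: Conv_obdd_def Conv_def convex_thicken convex_open_cube dest: openin_subset)
qed

section \<open>Transfer of identities\<close>

text \<open>The set \<open>Z\<close> treats both halves of the theorem at once: \<open>{}\<close>
  for all convex sets, \<open>{0}\<close> for those containing the origin. Its finiteness keeps the
  enlarged vertex sets finite. An inclusion is proved because the argument follows a single point
  from \<open>s\<close> to \<open>t\<close>.\<close>

lemma eval_term_subset_of_obdd:
  assumes obdd: "\<And>w. (\<And>i. w i \<in> lcarrier (Conv_obdd n) \<and> Z \<subseteq> w i) \<Longrightarrow>
      eval_term (Conv n) w s \<subseteq> eval_term (Conv n) w t"
    and "finite Z" and v: "\<And>i. v i \<in> lcarrier (Conv n) \<and> Z \<subseteq> v i"
  shows "eval_term (Conv n) v s \<subseteq> eval_term (Conv n) v t"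
proof
  fix p assume p: "p \<in> eval_term (Conv n) v s"
  have cv: "convex (v i)" "v i \<subseteq> topspace (Euclidean_space n)" for i
    using v[of i] by (auto simp: Conv_def)
  from eval_term_finite_support[OF cv(1) p] obtain G
    where G: "\<forall>i. finite (G i) \<and> G i \<subseteq> v i" "p \<in> eval_term (Conv n) (\<lambda>i. convex hull G i) s"
    by blast
  define F where "F i = G i \<union> Z" for i
  have F: "finite (F i)" "F i \<subseteq> v i" "Z \<subseteq> convex hull F i" for i
    using G(1) \<open>finite Z\<close> v by (auto simp: F_def hull_inc)
  have pF: "p \<in> eval_term (Conv n) (\<lambda>i. convex hull F i) s"
    by (rule subsetD[OF eval_term_mono G(2)]) (auto simp: F_def intro!: hull_mono)
  let ?V = "\<lambda>U e i. thicken U (convex hull F i) e"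
  \<comment> \<open>The parameter interval includes \<open>0\<close>, where the limit will be read
    off; the closed cube supplies compactness.\<close>
  let ?E = "SIGMA e:{0..1}. eval_term (Conv n) (?V (closed_cube n) e) t"
  have mem: "(e, p) \<in> ?E" if "0 < e" "e \<le> 1" for e
  proof -
    \<comment> \<open>Thickening only enlarges the polytopes, so monotonicity keeps \<open>p\<close>
      in the value of \<open>s\<close>.\<close>
    have s: "p \<in> eval_term (Conv n) (?V (open_cube n) e) s"
      by (rule subsetD[OF eval_term_mono pF]) (rule subset_thicken[OF zero_in_open_cube])
    have "?V (open_cube n) e i \<in> lcarrier (Conv_obdd n) \<and> Z \<subseteq> ?V (open_cube n) e i" for i
    proof
      show "?V (open_cube n) e i \<in> lcarrier (Conv_obdd n)"
        by (rule thicken_polytope_in_Conv_obdd[OF F(1) subset_trans[OF F(2) cv(2)] that(1)])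
      show "Z \<subseteq> ?V (open_cube n) e i"
        by (rule subset_trans[OF F(3) subset_thicken[OF zero_in_open_cube]])
    qed
    then have "p \<in> eval_term (Conv n) (?V (open_cube n) e) t"
      by (rule subsetD[OF obdd s])
    then have "p \<in> eval_term (Conv n) (?V (closed_cube n) e) t"
      by (rule subsetD[OF eval_term_mono, rotated])
        (rule thicken_mono[OF open_cube_subset_closed_cube])
    with that show ?thesis by (intro SigmaI) simp_all
  qed
  have "compact ?E"
    by (intro compact_Sigma_eval_term compact_Sigma_thicken compact_convex_hull_finite
        convex_thicken compact_closed_cube convex_closed_cube F(1) compact_Icc convex_convex_hull)
  then have "closed ?E" by (rule compact_imp_closed)
  moreover have "(1 / real (Suc k), p) \<in> ?E" for k
    by (rule mem) simp_all
  moreover have "(\<lambda>k. (1 / real (Suc k), p)) \<longlonglongrightarrow> (0, p)"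
    by (rule tendsto_Pair[OF _ tendsto_const])
      (use LIMSEQ_inverse_real_of_nat in \<open>simp only: inverse_eq_divide\<close>)
  ultimately have "(0, p) \<in> ?E"
    by (rule closed_sequentially)
  then have "p \<in> eval_term (Conv n) (?V (closed_cube n) 0) t" by (rule SigmaD2)
  \<comment> \<open>At \<open>e = 0\<close> nothing is added to the polytopes, and each of them lies
    in the convex set \<open>v i\<close> because its vertices do.\<close>
  then show "p \<in> eval_term (Conv n) v t"
  proof (rule subsetD[OF eval_term_mono, rotated])
    show "?V (closed_cube n) 0 i \<subseteq> v i" for i
      by (rule subset_trans[OF thicken_0 hull_minimal[of "F i" "v i" convex, OF F(2) cv(1)]])
  qed
qed

lemma satisfies_identity_iff_Conv_eval:
  assumes "meet L = meet (Conv n)" "join L = join (Conv n)"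
  shows "satisfies_identity L s t \<longleftrightarrow>
    (\<forall>v. (\<forall>i. v i \<in> lcarrier L) \<longrightarrow> eval_term (Conv n) v s = eval_term (Conv n) v t)"
  unfolding satisfies_identity_def eval_term_same_ops[OF assms] ..

text \<open>One direction restricts the valuations to a smaller carrier. The other applies the
  preceding inclusion twice, with \<open>s\<close> and \<open>t\<close> exchanged.\<close>

lemma satisfies_identity_restricted_iff:
  assumes "finite Z"
    and L: "meet L = meet (Conv n)" "join L = join (Conv n)"
      "lcarrier L = {S \<in> lcarrier (Conv n). Z \<subseteq> S}"
    and M: "meet M = meet (Conv n)" "join M = join (Conv n)"
      "lcarrier M = {S \<in> lcarrier (Conv_obdd n). Z \<subseteq> S}"
  shows "satisfies_identity L s t \<longleftrightarrow> satisfies_identity M s t"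
proof
  assume "satisfies_identity L s t"
  then show "satisfies_identity M s t"
    unfolding satisfies_identity_iff_Conv_eval[OF L(1,2)] satisfies_identity_iff_Conv_eval[OF M(1,2)]
      L(3) M(3) by (auto simp: Conv_obdd_def)
next
  assume "satisfies_identity M s t"
  then have eq: "eval_term (Conv n) w s = eval_term (Conv n) w t"
    if "\<And>i. w i \<in> lcarrier (Conv_obdd n) \<and> Z \<subseteq> w i" for w
    using that unfolding satisfies_identity_iff_Conv_eval[OF M(1,2)] M(3) by blast
  show "satisfies_identity L s t"
    unfolding satisfies_identity_iff_Conv_eval[OF L(1,2)] L(3)
  proof (intro allI impI equalityI)
    fix v :: "nat \<Rightarrow> (nat \<Rightarrow> real) set"
    assume "\<forall>i. v i \<in> {S \<in> lcarrier (Conv n). Z \<subseteq> S}"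
    then have v: "v i \<in> lcarrier (Conv n) \<and> Z \<subseteq> v i" for i by blast
    show "eval_term (Conv n) v s \<subseteq> eval_term (Conv n) v t"
      by (rule eval_term_subset_of_obdd[OF _ assms(1) v]) (simp add: eq)
    show "eval_term (Conv n) v t \<subseteq> eval_term (Conv n) v s"
      by (rule eval_term_subset_of_obdd[OF _ assms(1) v]) (simp add: eq)
  qed
qed

lemma variety_cong:
  "(\<And>s t. satisfies_identity L s t \<longleftrightarrow> satisfies_identity M s t) \<Longrightarrow> variety L = variety M"
  by (simp add: variety_def)

theorem theorem18:
  fixes n :: nat
  shows "(variety (Conv n) :: 'b lat set) = variety (Conv_obdd n) \<and>
         (variety (above_origin (Conv n)) :: 'b lat set) = variety (above_origin (Conv_obdd n))"
proof
  show "(variety (Conv n) :: 'b lat set) = variety (Conv_obdd n)"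
    by (rule variety_cong, rule satisfies_identity_restricted_iff[of "{}"])
      (auto simp: Conv_obdd_def)
  show "(variety (above_origin (Conv n)) :: 'b lat set) = variety (above_origin (Conv_obdd n))"
    by (rule variety_cong, rule satisfies_identity_restricted_iff[of "{0}"])
      (auto simp: Conv_obdd_def above_origin_def)
qed

end
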